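(* Let $E$ be a complex Banach space, let $I=\mathbb{R}$ or $I=[0,\infty)$, let $f:I\to E$ be a continuous function, and let $c\in\mathbb{C}$ with $|c|=1$ and $\arg(c)/\pi\notin\mathbb{Q}$. Put $S_1:=\{z\in\mathbb{C}:|z|=1\}$. (i) If $f$ is $c$-almost periodic, then $f$ is $c'$-almost periodic for all $c'\in S_1$. (ii) If $f$ is bounded and $c$-uniformly recurrent, then $f$ is $c'$-uniformly recurrent for all $c'\in S_1$.
   Context: Let $f:I\to E$ be continuous and $|c|=1$. $f$ is $c$-almost periodic if for each $\epsilon>0$ the set of all $\tau>0$ such that $\|f(t+\tau)-cf(t)\|\le\epsilon$ for all $t\in I$ is relatively dense in $[0,\infty)$, i.e. there exists $l>0$ such that every subinterval of $[0,\infty)$ of length $l$ meets this set. $f$ is $c$-uniformly recurrent if there exists a strictly increasing sequence $(\alpha_n)$ of positive reals with $\alpha_n\to+\infty$ and $\lim_{n\to\infty}\sup_{t\in I}\|f(t+\alpha_n)-cf(t)\|=0$. *)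

theory Defs
  imports "HOL-Analysis.Analysis"
begin

text \<open>
  A complex Banach space is a Banach space over the reals whose scalar multiplication
  extends to the complex numbers with a multiplicative norm; the unit law for
  \<open>scaleC\<close> follows from \<open>scaleC_of_real\<close>.
\<close>

class complex_banach = banach +
  fixes scaleC :: "complex \<Rightarrow> 'a \<Rightarrow> 'a"  (infixr \<open>*\<^sub>C\<close> 75)
  assumes scaleC_add_right: "a *\<^sub>C (x + y) = a *\<^sub>C x + a *\<^sub>C y"
    and scaleC_add_left: "(a + b) *\<^sub>C x = a *\<^sub>C x + b *\<^sub>C x"
    and scaleC_scaleC: "a *\<^sub>C b *\<^sub>C x = (a * b) *\<^sub>C x"
    and scaleC_of_real: "complex_of_real r *\<^sub>C x = r *\<^sub>R x"
    and norm_scaleC: "norm (a *\<^sub>C x) = cmod a * norm x"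

instantiation complex :: complex_banach
begin

definition scaleC_complex :: "complex \<Rightarrow> complex \<Rightarrow> complex"
  where "scaleC_complex a x = a * x"

instance
  by standard
    (simp_all add: scaleC_complex_def algebra_simps norm_mult scaleR_conv_of_real)

end

definition relatively_dense_nonneg :: "real set \<Rightarrow> bool" where
  "relatively_dense_nonneg T \<longleftrightarrow> (\<exists>l>0. \<forall>a\<ge>0. {a..a + l} \<inter> T \<noteq> {})"

text \<open>
  In the following two definitions \<open>f\<close> is a total function of which only the restriction to
  the domain \<open>I\<close> matters, provided \<open>I\<close> is closed under adding positive reals.
\<close>

definition c_almost_periodic ::
    "complex \<Rightarrow> real set \<Rightarrow> (real \<Rightarrow> 'a::complex_banach) \<Rightarrow> bool" where
  "c_almost_periodic c I f \<longleftrightarrow>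
     (\<forall>\<epsilon>>0. relatively_dense_nonneg {\<tau>. \<tau> > 0 \<and> (\<forall>t\<in>I. norm (f (t + \<tau>) - c *\<^sub>C f t) \<le> \<epsilon>)})"

text \<open>
  The supremum is taken in the extended reals, since it may be infinite for some indices
  when \<open>f\<close> is unbounded.
\<close>

definition c_uniformly_recurrent ::
    "complex \<Rightarrow> real set \<Rightarrow> (real \<Rightarrow> 'a::complex_banach) \<Rightarrow> bool" where
  "c_uniformly_recurrent c I f \<longleftrightarrow>
     (\<exists>\<alpha> :: nat \<Rightarrow> real. strict_mono \<alpha> \<and> (\<forall>n. \<alpha> n > 0) \<and> filterlim \<alpha> at_top sequentially \<and>
        (\<lambda>n. SUP t\<in>I. ereal (norm (f (t + \<alpha> n) - c *\<^sub>C f t))) \<longlonglongrightarrow> 0)"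

end

theory Submission
  imports Defs
begin

text \<open>
  Iterating a translation by \<open>\<tau>\<close> for which \<open>f(t + \<tau>)\<close> is \<open>\<delta>\<close>-close to \<open>c f(t)\<close> makes
  \<open>f(t + k\<tau>)\<close> be \<open>k\<delta>\<close>-close to \<open>c\<^sup>k f(t)\<close>, since multiplication by \<open>c\<close> does not increase
  errors (\<open>c_translations_mult\<close>). As the argument of \<open>c\<close> is an irrational multiple of \<open>\<pi>\<close>,
  Kronecker's theorem makes the powers \<open>c\<^sup>k\<close> with \<open>k > 0\<close> dense in the unit circle
  (\<open>powers_dense_in_circle\<close>). So \<open>k\<close> can be chosen with \<open>c\<^sup>k\<close> close to \<open>c'\<close>, and then \<open>\<delta>\<close> of
  order \<open>\<epsilon>/k\<close>. For bounded \<open>f\<close> the result is \<open>c_translations_change_multiplier\<close>: one fixed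
  \<open>k > 0\<close> turns all sufficiently good translation numbers for \<open>c\<close> into \<open>\<epsilon>\<close>-good ones for \<open>c'\<close>.

  Multiplication by a fixed \<open>k > 0\<close> preserves both relative density and unboundedness of a set
  of positive reals, and these are the properties of the sets of translation numbers that
  express almost periodicity and uniform recurrence. Boundedness is a hypothesis in the
  recurrent case; in the almost periodic case it is automatic, because the norm of every
  value of \<open>f\<close> differs by at most 1 from that of a value on one fixed compact interval
  (\<open>c_almost_periodic_bounded\<close>).
\<close>

definition c_translations ::
    "complex \<Rightarrow> real set \<Rightarrow> (real \<Rightarrow> 'a::complex_banach) \<Rightarrow> real \<Rightarrow> real set" where
  "c_translations c I f \<epsilon> = {\<tau>. \<tau> > 0 \<and> (\<forall>t\<in>I. norm (f (t + \<tau>) - c *\<^sub>C f t) \<le> \<epsilon>)}"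

lemma c_translationsD:
  assumes "\<tau> \<in> c_translations c I f \<epsilon>"
  shows "\<tau> > 0" and "t \<in> I \<Longrightarrow> norm (f (t + \<tau>) - c *\<^sub>C f t) \<le> \<epsilon>"
  using assms by (auto simp: c_translations_def)

lemma c_translations_mono: "\<epsilon> \<le> \<epsilon>' \<Longrightarrow> c_translations c I f \<epsilon> \<subseteq> c_translations c I f \<epsilon>'"
  by (force simp: c_translations_def)

lemma c_almost_periodic_iff:
  "c_almost_periodic c I f \<longleftrightarrow> (\<forall>\<epsilon>>0. relatively_dense_nonneg (c_translations c I f \<epsilon>))"
  by (simp add: c_almost_periodic_def c_translations_def)

lemma scaleC_one: "1 *\<^sub>C x = (x :: 'a::complex_banach)"
  using scaleC_of_real[of 1 x] by simp

lemma scaleC_diff_left: "(a - b) *\<^sub>C x = a *\<^sub>C x - b *\<^sub>C (x :: 'a::complex_banach)"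
  using scaleC_add_left[of "a - b" b x] by simp

lemma scaleC_diff_right: "a *\<^sub>C (x - y) = a *\<^sub>C x - a *\<^sub>C (y :: 'a::complex_banach)"
  using scaleC_add_right[of a "x - y" y] by simp


lemma cmod_cis_minus_one_le: "cmod (cis x - 1) \<le> \<bar>x\<bar>"
  using dist_exp_i_1[of x] abs_sin_x_le_abs_x[of "x / 2"] by (simp add: cis_conv_exp)

text \<open>
  On the level of angles this is one-dimensional inhomogeneous Kronecker approximation for
  the irrational number \<open>Arg c / (2\<pi>)\<close>; chords are shorter than the arcs they span.
\<close>

lemma powers_dense_in_circle:
  assumes c: "cmod c = 1" "Arg c / pi \<notin> \<rat>" and c': "cmod c' = 1" and "\<epsilon> > 0"
  obtains k :: nat where "k > 0" "cmod (c ^ k - c') < \<epsilon>"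
proof -
  define \<theta> where "\<theta> = Arg c / (2 * pi)"
  define \<alpha> where "\<alpha> = Arg c' / (2 * pi)"
  have "Arg c / pi = 2 * \<theta>"
    by (simp add: \<theta>_def)
  with c(2) have "\<theta> \<notin> \<rat>"
    by (metis Rats_mult Rats_number_of)
  moreover have "\<epsilon> / (2 * pi) > 0"
    using \<open>\<epsilon> > 0\<close> by simp
  ultimately obtain h k :: int
    where k: "k > 0" and hk: "\<bar>of_int k * \<theta> - of_int h - \<alpha>\<bar> < \<epsilon> / (2 * pi)"
    by (rule sequence_of_fractional_parts_is_dense)
  define x where "x = 2 * pi * (of_int k * \<theta> - of_int h - \<alpha>)"
  have x: "x = real (nat k) * Arg c - Arg c' - 2 * pi * of_int h"
    using k by (simp add: x_def \<theta>_def \<alpha>_def field_simps)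
  have c_cis: "c = cis (Arg c)" and c'_cis: "c' = cis (Arg c')"
    using rcis_cmod_Arg[of c] rcis_cmod_Arg[of c'] c(1) c' by (simp_all add: rcis_def)
  have "c ^ nat k = cis (Arg c) ^ nat k"
    using c_cis by (rule arg_cong)
  also have "\<dots> = cis (real (nat k) * Arg c)"
    by (rule Complex.DeMoivre)
  also have "\<dots> = cis (x + Arg c' + 2 * pi * of_int h)"
    by (simp add: x)
  also have "\<dots> = cis x * cis (Arg c')"
    by (simp flip: cis_mult)
  finally have "c ^ nat k - c' = (cis x - 1) * c'"
    using c'_cis by (simp add: algebra_simps)
  hence "cmod (c ^ nat k - c') \<le> \<bar>x\<bar>"
    using cmod_cis_minus_one_le[of x] c' by (simp add: norm_mult)
  also have "\<bar>x\<bar> = \<bar>of_int k * \<theta> - of_int h - \<alpha>\<bar> * (2 * pi)"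
    by (simp add: x_def abs_mult)
  also have "\<dots> < \<epsilon>"
    using hk by (simp add: pos_less_divide_eq)
  finally show thesis
    using that[of "nat k"] k by simp
qed


text \<open>
  Each further translation contributes a new error of at most \<open>\<epsilon>\<close> and multiplies the old one
  by \<open>c\<close>, so errors add up linearly rather than geometrically.
\<close>

lemma c_translations_mult:
  assumes I: "\<And>t s. t \<in> I \<Longrightarrow> s \<ge> 0 \<Longrightarrow> t + s \<in> I"
    and c: "cmod c \<le> 1" and \<tau>: "\<tau> \<in> c_translations c I f \<epsilon>" and "k > 0"
  shows "real k * \<tau> \<in> c_translations (c ^ k) I f (real k * \<epsilon>)"
proof -
  have "norm (f (t + real k * \<tau>) - (c ^ k) *\<^sub>C f t) \<le> real k * \<epsilon>" if "t \<in> I" for t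
  proof (induction k)
    case 0
    show ?case by (simp add: scaleC_one)
  next
    case (Suc k)
    define s where "s = t + real k * \<tau>"
    have "s \<in> I"
      using I[OF that, of "real k * \<tau>"] c_translationsD(1)[OF \<tau>] by (simp add: s_def)
    have "f (s + \<tau>) - (c ^ Suc k) *\<^sub>C f t
        = (f (s + \<tau>) - c *\<^sub>C f s) + c *\<^sub>C (f s - (c ^ k) *\<^sub>C f t)"
      by (simp add: scaleC_diff_right scaleC_scaleC)
    also have "norm \<dots> \<le> \<epsilon> + cmod c * norm (f s - (c ^ k) *\<^sub>C f t)"
      using c_translationsD(2)[OF \<tau> \<open>s \<in> I\<close>] by (intro norm_triangle_mono) (simp_all add: norm_scaleC)
    also have "\<dots> \<le> \<epsilon> + 1 * (real k * \<epsilon>)"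
      using Suc c unfolding s_def by (intro add_left_mono mult_mono) auto
    finally show ?case
      by (simp add: s_def algebra_simps)
  qed
  thus ?thesis
    using c_translationsD(1)[OF \<tau>] \<open>k > 0\<close> by (simp add: c_translations_def)
qed

lemma c_translations_perturb:
  assumes \<tau>: "\<tau> \<in> c_translations c I f \<epsilon>"
    and M: "\<And>t. t \<in> I \<Longrightarrow> norm (f t) \<le> M"
  shows "\<tau> \<in> c_translations c' I f (\<epsilon> + cmod (c - c') * M)"
proof -
  have "norm (f (t + \<tau>) - c' *\<^sub>C f t) \<le> \<epsilon> + cmod (c - c') * M" if "t \<in> I" for t
  proof -
    have "f (t + \<tau>) - c' *\<^sub>C f t = (f (t + \<tau>) - c *\<^sub>C f t) + (c - c') *\<^sub>C f t"
      by (simp add: scaleC_diff_left)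
    also have "norm \<dots> \<le> \<epsilon> + cmod (c - c') * M"
      using c_translationsD(2)[OF \<tau> that] M[OF that]
      by (intro norm_triangle_mono) (auto simp: norm_scaleC intro: mult_left_mono)
    finally show ?thesis .
  qed
  thus ?thesis
    using c_translationsD(1)[OF \<tau>] by (simp add: c_translations_def)
qed

text \<open>
  The factor \<open>k\<close> depends on \<open>\<epsilon>\<close> but not on \<open>\<tau>\<close>. This uniformity is what lets relative density
  pass from one set of translation numbers to the other.
\<close>

lemma c_translations_change_multiplier:
  assumes I: "\<And>t s. t \<in> I \<Longrightarrow> s \<ge> 0 \<Longrightarrow> t + s \<in> I"
    and bdd: "bounded (f ` I)"
    and c: "cmod c = 1" "Arg c / pi \<notin> \<rat>" and c': "cmod c' = 1" and "\<epsilon> > 0"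
  obtains k :: nat and \<delta> where "k > 0" "\<delta> > 0"
    "\<And>\<tau>. \<tau> \<in> c_translations c I f \<delta> \<Longrightarrow> real k * \<tau> \<in> c_translations c' I f \<epsilon>"
proof -
  obtain M where "M > 0" and M: "\<And>t. t \<in> I \<Longrightarrow> norm (f t) \<le> M"
    using bdd by (auto simp: bounded_pos)
  have "\<epsilon> / (2 * M) > 0"
    using \<open>\<epsilon> > 0\<close> \<open>M > 0\<close> by simp
  then obtain k :: nat where k: "k > 0" "cmod (c ^ k - c') < \<epsilon> / (2 * M)"
    by (rule powers_dense_in_circle[OF c c'])
  (* Half of the error budget is for the k translations, half for replacing c^k by c'. *)
  define \<delta> where "\<delta> = \<epsilon> / (2 * real k)"
  show thesis
  proof (rule that[of k \<delta>])
    show "k > 0" "\<delta> > 0"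
      using k \<open>\<epsilon> > 0\<close> by (simp_all add: \<delta>_def)
    fix \<tau> assume "\<tau> \<in> c_translations c I f \<delta>"
    hence "real k * \<tau> \<in> c_translations (c ^ k) I f (real k * \<delta>)"
      using I c(1) k(1) by (intro c_translations_mult) auto
    hence "real k * \<tau> \<in> c_translations c' I f (real k * \<delta> + cmod (c ^ k - c') * M)"
      using M by (rule c_translations_perturb)
    moreover have "real k * \<delta> + cmod (c ^ k - c') * M \<le> \<epsilon>"
      using k \<open>M > 0\<close> by (simp add: \<delta>_def field_simps)
    ultimately show "real k * \<tau> \<in> c_translations c' I f \<epsilon>"
      using c_translations_mono by blast
  qed
qed


lemma relatively_dense_nonneg_scale:
  assumes T: "relatively_dense_nonneg T" and "r > 0" and sub: "\<And>\<tau>. \<tau> \<in> T \<Longrightarrow> r * \<tau> \<in> T'"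
  shows "relatively_dense_nonneg T'"
proof -
  obtain l where "l > 0" and l: "\<And>a. a \<ge> 0 \<Longrightarrow> {a..a + l} \<inter> T \<noteq> {}"
    using T by (auto simp: relatively_dense_nonneg_def)
  have "{a..a + r * l} \<inter> T' \<noteq> {}" if "a \<ge> 0" for a
  proof -
    obtain \<tau> where "\<tau> \<in> T" "a / r \<le> \<tau>" "\<tau> \<le> a / r + l"
      using l[of "a / r"] \<open>a \<ge> 0\<close> \<open>r > 0\<close> by auto
    hence "r * \<tau> \<in> {a..a + r * l}"
      using \<open>r > 0\<close> by (simp add: field_simps)
    with sub[OF \<open>\<tau> \<in> T\<close>] show ?thesis by blast
  qed
  moreover have "r * l > 0"
    using \<open>r > 0\<close> \<open>l > 0\<close> by simp
  ultimately show ?thesis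
    unfolding relatively_dense_nonneg_def by blast
qed

text \<open>
  Every point of the domain can be moved into a fixed compact interval \<open>[0, l]\<close> by a translation
  number for the error 1: points to the right of it are reached from inside, and negative
  points are carried into it. Since \<open>|c| = 1\<close>, either move changes the norm of \<open>f\<close> by at most 1.
\<close>

lemma c_almost_periodic_bounded:
  fixes f :: "real \<Rightarrow> 'a::complex_banach"
  assumes I: "I = UNIV \<or> I = {0..}" and cont: "continuous_on I f" and c: "cmod c = 1"
    and ap: "c_almost_periodic c I f"
  shows "bounded (f ` I)"
proof -
  have "relatively_dense_nonneg (c_translations c I f 1)"
    using ap by (simp add: c_almost_periodic_iff)
  then obtain l where "l > 0" and l: "\<And>a. a \<ge> 0 \<Longrightarrow> {a..a + l} \<inter> c_translations c I f 1 \<noteq> {}"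
    by (auto simp: relatively_dense_nonneg_def)
  have "{0..l} \<subseteq> I"
    using I by auto
  hence "bounded (f ` {0..l})"
    by (intro compact_imp_bounded compact_continuous_image continuous_on_subset[OF cont]) auto
  then obtain M where M: "\<And>t. 0 \<le> t \<Longrightarrow> t \<le> l \<Longrightarrow> norm (f t) \<le> M"
    unfolding bounded_iff by (metis atLeastAtMost_iff imageI)
  have step: "\<bar>norm (f (t + \<tau>)) - norm (f t)\<bar> \<le> 1"
    if "\<tau> \<in> c_translations c I f 1" "t \<in> I" for t \<tau>
    using c_translationsD(2)[OF that] norm_triangle_ineq3[of "f (t + \<tau>)" "c *\<^sub>C f t"] c
    by (simp add: norm_scaleC)
  have "norm (f t) \<le> M + 1" if "t \<in> I" for t
  proof -
    consider "0 \<le> t" "t \<le> l" | "t > l" | "t < 0" by linarith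
    thus ?thesis
    proof cases
      case 1
      thus ?thesis using M[of t] by simp
    next
      case 2
      then obtain \<tau> where \<tau>: "\<tau> \<in> c_translations c I f 1" "t - l \<le> \<tau>" "\<tau> \<le> t"
        using l[of "t - l"] by auto
      hence "t - \<tau> \<in> I"
        using I by auto
      thus ?thesis
        using step[OF \<tau>(1), of "t - \<tau>"] M[of "t - \<tau>"] \<tau>(2,3) by simp
    next
      case 3
      then obtain \<tau> where \<tau>: "\<tau> \<in> c_translations c I f 1" "- t \<le> \<tau>" "\<tau> \<le> - t + l"
        using l[of "- t"] by auto
      thus ?thesis
        using step[OF \<tau>(1) that] M[of "t + \<tau>"] by simp
    qed
  qed
  thus ?thesis
    by (auto simp: bounded_iff)
qed

text \<open>
  In the nontrivial direction the sequence is built recursively, the \<open>n\<close>-th term being a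
  translation number with error \<open>1/(n+1)\<close> beyond both \<open>n\<close> and the preceding term.
  Nonemptiness matters because the supremum over the empty set is \<open>-\<infinity>\<close>.
\<close>

lemma c_uniformly_recurrent_iff:
  assumes "I \<noteq> {}"
  shows "c_uniformly_recurrent c I f \<longleftrightarrow>
    (\<forall>\<epsilon>>0. \<forall>A. \<exists>\<tau>\<in>c_translations c I f \<epsilon>. \<tau> > A)"
proof (intro iffI allI impI)
  fix \<epsilon> A :: real
  assume "c_uniformly_recurrent c I f" and "\<epsilon> > 0"
  then obtain \<alpha> :: "nat \<Rightarrow> real" where pos: "\<And>n. \<alpha> n > 0" and top: "filterlim \<alpha> at_top sequentially"
    and lim: "(\<lambda>n. SUP t\<in>I. ereal (norm (f (t + \<alpha> n) - c *\<^sub>C f t))) \<longlonglongrightarrow> 0"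
    unfolding c_uniformly_recurrent_def by blast
  have "\<forall>\<^sub>F n in sequentially. (SUP t\<in>I. ereal (norm (f (t + \<alpha> n) - c *\<^sub>C f t))) < ereal \<epsilon>"
    using order_tendstoD(2)[OF lim] \<open>\<epsilon> > 0\<close> by simp
  moreover have "\<forall>\<^sub>F n in sequentially. \<alpha> n > A"
    using top by (simp add: filterlim_at_top_dense)
  ultimately have "\<forall>\<^sub>F n in sequentially.
      (SUP t\<in>I. ereal (norm (f (t + \<alpha> n) - c *\<^sub>C f t))) < ereal \<epsilon> \<and> \<alpha> n > A"
    by (rule eventually_conj)
  then obtain n where n: "(SUP t\<in>I. ereal (norm (f (t + \<alpha> n) - c *\<^sub>C f t))) < ereal \<epsilon>" "\<alpha> n > A"
    using eventually_happens'[OF sequentially_bot] by blast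
  have "norm (f (t + \<alpha> n) - c *\<^sub>C f t) \<le> \<epsilon>" if "t \<in> I" for t
    using SUP_lessD[OF n(1) that] by simp
  thus "\<exists>\<tau>\<in>c_translations c I f \<epsilon>. \<tau> > A"
    using n(2) pos by (intro bexI[of _ "\<alpha> n"]) (auto simp: c_translations_def)
next
  assume *: "\<forall>\<epsilon>>0. \<forall>A. \<exists>\<tau>\<in>c_translations c I f \<epsilon>. \<tau> > A"
  have "\<exists>\<alpha>. \<forall>n. (\<alpha> n \<in> c_translations c I f (1 / real (Suc n)) \<and> \<alpha> n > real n) \<and> \<alpha> n < \<alpha> (Suc n)"
  proof (rule dependent_nat_choice)
    show "\<exists>x. x \<in> c_translations c I f (1 / real (Suc 0)) \<and> x > real 0"
      using *[rule_format, of "1 / real (Suc 0)" "real 0"] by auto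
  next
    fix x :: real and n
    show "\<exists>y. (y \<in> c_translations c I f (1 / real (Suc (Suc n))) \<and> y > real (Suc n)) \<and> x < y"
      using *[rule_format, of "1 / real (Suc (Suc n))" "max x (real (Suc n))"] by auto
  qed
  then obtain \<alpha> where \<alpha>: "\<And>n. \<alpha> n \<in> c_translations c I f (1 / real (Suc n))"
      "\<And>n. \<alpha> n > real n" "\<And>n. \<alpha> n < \<alpha> (Suc n)"
    by blast
  have "filterlim \<alpha> at_top sequentially"
    by (rule filterlim_at_top_mono[OF filterlim_real_sequentially]) (simp add: \<alpha>(2) less_imp_le)
  moreover have "(\<lambda>n. SUP t\<in>I. ereal (norm (f (t + \<alpha> n) - c *\<^sub>C f t))) \<longlonglongrightarrow> 0"
  proof (rule tendsto_sandwich)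
    show "\<forall>\<^sub>F n in sequentially. 0 \<le> (SUP t\<in>I. ereal (norm (f (t + \<alpha> n) - c *\<^sub>C f t)))"
      using \<open>I \<noteq> {}\<close> by (intro always_eventually allI) (auto intro: SUP_upper2)
    show "\<forall>\<^sub>F n in sequentially.
        (SUP t\<in>I. ereal (norm (f (t + \<alpha> n) - c *\<^sub>C f t))) \<le> ereal (1 / real (Suc n))"
      using c_translationsD(2)[OF \<alpha>(1)]
      by (intro always_eventually allI SUP_least) (simp only: ereal_less_eq)
    show "(\<lambda>n. ereal (1 / real (Suc n))) \<longlonglongrightarrow> 0"
      using LIMSEQ_inverse_real_of_nat by (simp add: zero_ereal_def inverse_eq_divide)
  qed simp
  ultimately show "c_uniformly_recurrent c I f"
    unfolding c_uniformly_recurrent_def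
    using \<alpha>(3) c_translationsD(1)[OF \<alpha>(1)] by (intro exI[of _ \<alpha>]) (auto intro: strict_monoI_Suc)
qed


theorem proposition2p11:
  fixes f :: "real \<Rightarrow> 'a::complex_banach" and I :: "real set" and c :: complex
  assumes "I = UNIV \<or> I = {0..}"
    and "continuous_on I f"
    and "cmod c = 1"
    and "Arg c / pi \<notin> \<rat>"
  shows "(c_almost_periodic c I f \<longrightarrow>
            (\<forall>c'\<in>{z::complex. cmod z = 1}. c_almost_periodic c' I f)) \<and>
         (bounded (f ` I) \<and> c_uniformly_recurrent c I f \<longrightarrow>
            (\<forall>c'\<in>{z::complex. cmod z = 1}. c_uniformly_recurrent c' I f))"
proof (intro conjI impI ballI)
  have I: "t + s \<in> I" if "t \<in> I" "s \<ge> 0" for t s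
    using assms(1) that by auto
  have "I \<noteq> {}"
    using assms(1) by auto
  fix c' :: complex assume "c' \<in> {z. cmod z = 1}"
  hence c': "cmod c' = 1" by simp
  note change = c_translations_change_multiplier[OF I _ assms(3,4) c', of f]
  {
    assume ap: "c_almost_periodic c I f"
    have bdd: "bounded (f ` I)"
      using assms(1,2,3) ap by (rule c_almost_periodic_bounded)
    show "c_almost_periodic c' I f"
      unfolding c_almost_periodic_iff
    proof (intro allI impI)
      fix \<epsilon> :: real assume "\<epsilon> > 0"
      obtain k :: nat and \<delta> where "k > 0" "\<delta> > 0" and
        k: "\<And>\<tau>. \<tau> \<in> c_translations c I f \<delta> \<Longrightarrow> real k * \<tau> \<in> c_translations c' I f \<epsilon>"
        using change bdd \<open>\<epsilon> > 0\<close> by metis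
      have "relatively_dense_nonneg (c_translations c I f \<delta>)"
        using ap \<open>\<delta> > 0\<close> by (simp add: c_almost_periodic_iff)
      thus "relatively_dense_nonneg (c_translations c' I f \<epsilon>)"
        by (rule relatively_dense_nonneg_scale[where r = "real k"]) (use \<open>k > 0\<close> k in auto)
    qed
  }
  {
    assume "bounded (f ` I) \<and> c_uniformly_recurrent c I f"
    hence bdd: "bounded (f ` I)" and ur: "c_uniformly_recurrent c I f" by auto
    show "c_uniformly_recurrent c' I f"
      unfolding c_uniformly_recurrent_iff[OF \<open>I \<noteq> {}\<close>]
    proof (intro allI impI)
      fix \<epsilon> A :: real assume "\<epsilon> > 0"
      obtain k :: nat and \<delta> where "k > 0" "\<delta> > 0" and
        k: "\<And>\<tau>. \<tau> \<in> c_translations c I f \<delta> \<Longrightarrow> real k * \<tau> \<in> c_translations c' I f \<epsilon>"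
        using change bdd \<open>\<epsilon> > 0\<close> by metis
      obtain \<tau> where "\<tau> \<in> c_translations c I f \<delta>" "\<tau> > A / real k"
        using ur \<open>\<delta> > 0\<close> unfolding c_uniformly_recurrent_iff[OF \<open>I \<noteq> {}\<close>] by blast
      with k \<open>k > 0\<close> show "\<exists>\<tau>\<in>c_translations c' I f \<epsilon>. \<tau> > A"
        by (intro bexI[of _ "real k * \<tau>"]) (auto simp: field_simps)
    qed
  }
qed

end
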